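(* Let $M$ be an oriented surface immersed in $\mathbb{R}^3$ and $m\in M$. A unit vector $v\in T_mM$ is an extremal direction of the frontal geodesic deviation of $M$ at $m$ if and only if $v$ is an asymptotic direction (that is, the normal curvature in the direction $v$ vanishes) or a principal direction of $M$ at $m$.
   Context: $\alpha$ denotes the second fundamental form of $M$, $\alpha(X,Y)=(D_XY)^\bot$ (normal component of the directional derivative in $\mathbb{R}^3$). For a unit vector $v\in T_mM$, the frontal (geodesic) deviation of $M$ in the direction $v$ is $-\frac16\alpha(v,v)\cdot\alpha(v,v)$. Fix an orthonormal basis $(t_1,t_2)$ of $T_mM$ and write unit vectors as $v(\theta)=\cos\theta\, t_1+\sin\theta\, t_2$. A direction $v(\theta_0)$ is called an extremal direction of the frontal deviation if the derivative with respect to $\theta$ of the frontal deviation in the direction $v(\theta)$ (equivalently, of $\|\alpha(v(\theta),v(\theta))\|^2$) vanishes at $\theta_0$. The normal curvature in the direction $v$ is $\alpha(v,v)\cdot N$, where $N$ is the unit normal; principal directions are the eigendirections of the shape operator (at an umbilic point every direction is principal). *)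

theory Defs
  imports "HOL-Analysis.Analysis"
begin

section \<open>Smooth maps on open subsets of Euclidean spaces\<close>

text \<open>Only meant for open sets. Derivatives of order \<open>n\<close> are iterated directional derivatives.\<close>

primrec C_k_on :: "nat \<Rightarrow> ('a::real_normed_vector) set \<Rightarrow> ('a \<Rightarrow> 'b::real_normed_vector) \<Rightarrow> bool" where
  "C_k_on 0 S g \<longleftrightarrow> continuous_on S g"
| "C_k_on (Suc n) S g \<longleftrightarrow> (\<forall>x\<in>S. g differentiable (at x)) \<and>
      (\<forall>v. C_k_on n S (\<lambda>x. frechet_derivative g (at x) v))"

definition smooth_on :: "('a::real_normed_vector) set \<Rightarrow> ('a \<Rightarrow> 'b::real_normed_vector) \<Rightarrow> bool" where
  "smooth_on S g \<longleftrightarrow> (\<forall>n. C_k_on n S g)"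


section \<open>Oriented surfaces and immersions\<close>

text \<open>A local parametrization \<open>(W, \<psi>)\<close> is the inverse of a chart: a homeomorphism \<open>\<psi>\<close> from an
  open set \<open>W\<close> of the plane onto an open set of the surface. The values of \<open>\<psi>\<close> outside \<open>W\<close> are
  irrelevant.\<close>

type_synonym 'a param = "(real^2) set \<times> (real^2 \<Rightarrow> 'a)"

definition local_param :: "'a topology \<Rightarrow> 'a param \<Rightarrow> bool" where
  "local_param M = (\<lambda>(W, \<psi>). open W \<and> openin M (\<psi> ` W) \<and>
      homeomorphic_map (top_of_set W) (subtopology M (\<psi> ` W)) \<psi>)"

definition smooth_surface :: "'a topology \<Rightarrow> 'a param set \<Rightarrow> bool" where
  "smooth_surface M A \<longleftrightarrow>
      Hausdorff_space M \<and> second_countable M \<and>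
      (\<forall>P\<in>A. local_param M P) \<and>
      topspace M = (\<Union>(W, \<psi>)\<in>A. \<psi> ` W) \<and>
      (\<forall>(W, \<psi>)\<in>A. \<forall>(V, \<phi>)\<in>A. smooth_on (W \<inter> \<psi> -` (\<phi> ` V)) (inv_into V \<phi> \<circ> \<psi>))"

definition oriented_surface :: "'a topology \<Rightarrow> 'a param set \<Rightarrow> bool" where
  "oriented_surface M A \<longleftrightarrow> smooth_surface M A \<and>
      (\<forall>(W, \<psi>)\<in>A. \<forall>(V, \<phi>)\<in>A. \<forall>p \<in> W \<inter> \<psi> -` (\<phi> ` V).
          det (matrix (frechet_derivative (inv_into V \<phi> \<circ> \<psi>) (at p))) > 0)"

definition smooth_map_on :: "'a param set \<Rightarrow> 'a set \<Rightarrow> ('a \<Rightarrow> 'b::real_normed_vector) \<Rightarrow> bool" where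
  "smooth_map_on A U g \<longleftrightarrow> (\<forall>(W, \<psi>)\<in>A. smooth_on (W \<inter> \<psi> -` U) (g \<circ> \<psi>))"

definition immersion :: "'a topology \<Rightarrow> 'a param set \<Rightarrow> ('a \<Rightarrow> real^3) \<Rightarrow> bool" where
  "immersion M A f \<longleftrightarrow> smooth_map_on A (topspace M) f \<and>
      (\<forall>(W, \<psi>)\<in>A. \<forall>p\<in>W. inj (frechet_derivative (f \<circ> \<psi>) (at p)))"


section \<open>Extrinsic geometry of an immersed surface\<close>

text \<open>The tangent space at \<open>m\<close> is identified with its image under the differential of the
  immersion, a plane in \<open>\<real>\<^sup>3\<close> through the origin. All parametrizations around \<open>m\<close> give the same
  plane.\<close>

definition tangent_space :: "'a param set \<Rightarrow> ('a \<Rightarrow> real^3) \<Rightarrow> 'a \<Rightarrow> (real^3) set" where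
  "tangent_space A f m = {x. \<exists>(W, \<psi>)\<in>A. \<exists>p\<in>W. \<psi> p = m \<and>
      (\<exists>a. x = frechet_derivative (f \<circ> \<psi>) (at p) a)}"

text \<open>The unit normal (Gauss map) determined by the orientation; it does not depend on the
  parametrization because the transition maps have positive Jacobian determinant. Here \<open>sgn\<close> is
  normalization, \<open>sgn w = w /\<^sub>R norm w\<close>.\<close>

definition unit_normal :: "'a param set \<Rightarrow> ('a \<Rightarrow> real^3) \<Rightarrow> 'a \<Rightarrow> real^3" where
  "unit_normal A f m = (THE n. \<exists>(W, \<psi>)\<in>A. \<exists>p\<in>W. \<psi> p = m \<and>
      n = sgn (cross3 (frechet_derivative (f \<circ> \<psi>) (at p) (axis 1 1))
                      (frechet_derivative (f \<circ> \<psi>) (at p) (axis 2 1))))"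

definition normal_component :: "'a param set \<Rightarrow> ('a \<Rightarrow> real^3) \<Rightarrow> 'a \<Rightarrow> real^3 \<Rightarrow> real^3" where
  "normal_component A f m w =
      (THE n. (\<forall>x\<in>tangent_space A f m. orthogonal n x) \<and> w - n \<in> tangent_space A f m)"

text \<open>The derivative \<open>D\<^sub>X g\<close> at \<open>m\<close> of a vector-valued function \<open>g\<close> on the surface, for a tangent
  vector \<open>X\<close> at \<open>m\<close>; by the chain rule it does not depend on the parametrization.\<close>

definition directional_deriv ::
    "'a param set \<Rightarrow> ('a \<Rightarrow> real^3) \<Rightarrow> 'a \<Rightarrow> real^3 \<Rightarrow> ('a \<Rightarrow> real^3) \<Rightarrow> real^3" where
  "directional_deriv A f m X g = (THE w. \<exists>(W, \<psi>)\<in>A. \<exists>p\<in>W. \<psi> p = m \<and>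
      (\<exists>a. X = frechet_derivative (f \<circ> \<psi>) (at p) a \<and>
           w = frechet_derivative (g \<circ> \<psi>) (at p) a))"

definition tangent_field_on ::
    "'a param set \<Rightarrow> ('a \<Rightarrow> real^3) \<Rightarrow> 'a set \<Rightarrow> ('a \<Rightarrow> real^3) \<Rightarrow> bool" where
  "tangent_field_on A f U Y \<longleftrightarrow> smooth_map_on A U Y \<and> (\<forall>q\<in>U. Y q \<in> tangent_space A f q)"

text \<open>The second fundamental form of two tangent vectors \<open>X, y\<close> at \<open>m\<close>: the normal component
  of \<open>D\<^sub>X Y\<close> for any smooth local tangent field \<open>Y\<close> with \<open>Y m = y\<close>. The value does not depend on the
  extension \<open>Y\<close>.\<close>

definition second_fundamental_form ::
    "'a topology \<Rightarrow> 'a param set \<Rightarrow> ('a \<Rightarrow> real^3) \<Rightarrow> 'a \<Rightarrow> real^3 \<Rightarrow> real^3 \<Rightarrow> real^3" where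
  "second_fundamental_form M A f m X y = (THE w. \<exists>U Y. openin M U \<and> m \<in> U \<and>
      tangent_field_on A f U Y \<and> Y m = y \<and>
      w = normal_component A f m (directional_deriv A f m X Y))"

definition normal_curvature ::
    "'a topology \<Rightarrow> 'a param set \<Rightarrow> ('a \<Rightarrow> real^3) \<Rightarrow> 'a \<Rightarrow> real^3 \<Rightarrow> real" where
  "normal_curvature M A f m v = second_fundamental_form M A f m v v \<bullet> unit_normal A f m"

definition asymptotic_direction ::
    "'a topology \<Rightarrow> 'a param set \<Rightarrow> ('a \<Rightarrow> real^3) \<Rightarrow> 'a \<Rightarrow> real^3 \<Rightarrow> bool" where
  "asymptotic_direction M A f m v \<longleftrightarrow> v \<in> tangent_space A f m \<and> v \<noteq> 0 \<and>
      normal_curvature M A f m v = 0"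

definition shape_operator :: "'a param set \<Rightarrow> ('a \<Rightarrow> real^3) \<Rightarrow> 'a \<Rightarrow> real^3 \<Rightarrow> real^3" where
  "shape_operator A f m v = - directional_deriv A f m v (unit_normal A f)"

definition principal_direction :: "'a param set \<Rightarrow> ('a \<Rightarrow> real^3) \<Rightarrow> 'a \<Rightarrow> real^3 \<Rightarrow> bool" where
  "principal_direction A f m v \<longleftrightarrow> v \<in> tangent_space A f m \<and> v \<noteq> 0 \<and>
      (\<exists>k. shape_operator A f m v = k *\<^sub>R v)"


section \<open>Frontal deviation\<close>

definition frontal_deviation ::
    "'a topology \<Rightarrow> 'a param set \<Rightarrow> ('a \<Rightarrow> real^3) \<Rightarrow> 'a \<Rightarrow> real^3 \<Rightarrow> real" where
  "frontal_deviation M A f m v =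
      - (1/6) * (second_fundamental_form M A f m v v \<bullet> second_fundamental_form M A f m v v)"

definition orthonormal_basis_of :: "(real^3) set \<Rightarrow> real^3 \<Rightarrow> real^3 \<Rightarrow> bool" where
  "orthonormal_basis_of T t1 t2 \<longleftrightarrow>
      norm t1 = 1 \<and> norm t2 = 1 \<and> orthogonal t1 t2 \<and> span {t1, t2} = T"

definition unit_direction :: "real^3 \<Rightarrow> real^3 \<Rightarrow> real \<Rightarrow> real^3" where
  "unit_direction t1 t2 \<theta> = cos \<theta> *\<^sub>R t1 + sin \<theta> *\<^sub>R t2"

definition extremal_direction ::
    "'a topology \<Rightarrow> 'a param set \<Rightarrow> ('a \<Rightarrow> real^3) \<Rightarrow> 'a \<Rightarrow> real^3 \<Rightarrow> real^3 \<Rightarrow> real^3 \<Rightarrow> bool" where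
  "extremal_direction M A f m t1 t2 v \<longleftrightarrow> (\<exists>\<theta>\<^sub>0. v = unit_direction t1 t2 \<theta>\<^sub>0 \<and>
      ((\<lambda>\<theta>. frontal_deviation M A f m (unit_direction t1 t2 \<theta>)) has_real_derivative 0) (at \<theta>\<^sub>0))"

end

theory Submission
  imports Defs
begin

text \<open>Write \<open>S\<close> for the shape operator and \<open>N\<close> for the unit normal at \<open>m\<close>. The proof rests on two
  facts of classical surface theory. The first is \<open>\<alpha>(X, y) = (S X \<bullet> y) N\<close>
  (\<open>second_fundamental_form_eq\<close>), which comes from differentiating \<open>Y \<bullet> N = 0\<close> for a tangent field
  \<open>Y\<close> (\<open>weingarten\<close>). The second is that \<open>S\<close> is a self-adjoint endomorphism of the tangent plane
  (\<open>shape_operator_tangent\<close>, \<open>shape_operator_symmetric\<close>), where self-adjointness is the symmetry of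
  second derivatives (\<open>mixed_derivatives_commute\<close>).

  Since \<open>N\<close> is a unit vector, the frontal deviation in the direction \<open>v = v(\<theta>)\<close> is
  \<open>-(S v \<bullet> v)\<^sup>2 / 6\<close>. Self-adjointness gives its derivative in \<open>\<theta>\<close> as
  \<open>-(2/3) (S v \<bullet> v) (S v \<bullet> w)\<close>, where \<open>w = v(\<theta> + \<pi>/2)\<close> is the derivative of \<open>v(\<theta>)\<close>
  (\<open>frontal_deviation_derivative\<close>). The first factor is the normal curvature, so it vanishes exactly
  in the asymptotic directions. The second vanishes exactly when \<open>S v\<close>, which lies in the plane
  spanned by the orthonormal vectors \<open>v\<close> and \<open>w\<close>, is a multiple of \<open>v\<close>, that is, when \<open>v\<close> is
  principal (\<open>eigenvector_iff_orthogonal_to_rotation\<close>).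

  The geometric objects are given as the unique value computed in any chart. Each is first
  evaluated in one chart, the choice being immaterial by \<open>chart_change\<close>. For the second
  fundamental form there must also be a tangent field with a prescribed value; coordinate fields
  provide it, and their smoothness in all charts is why \<open>C\<^sup>n\<close> maps have to be closed under
  composition (\<open>C_k_on_compose\<close>).\<close>

section \<open>Calculus of smooth maps\<close>

abbreviation Dif :: "('a::real_normed_vector \<Rightarrow> 'b::real_normed_vector) \<Rightarrow> 'a \<Rightarrow> 'a \<Rightarrow> 'b" where
  "Dif g x \<equiv> frechet_derivative g (at x)"

lemma Dif_eqI: "(g has_derivative g') (at x) \<Longrightarrow> Dif g x = g'"
  by (metis frechet_derivative_at)

lemma differentiable_Dif: "g differentiable at x \<Longrightarrow> (g has_derivative Dif g x) (at x)"
  by (simp add: frechet_derivative_works)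

lemma Dif_cong:
  assumes "open S" "x \<in> S" "\<And>y. y \<in> S \<Longrightarrow> g y = h y" "g differentiable at x"
  shows "h differentiable at x" "Dif h x = Dif g x"
proof -
  have "(h has_derivative Dif g x) (at x)"
    using has_derivative_transform_within_open[OF differentiable_Dif[OF assms(4)] assms(1,2,3)] .
  then show "h differentiable at x" "Dif h x = Dif g x"
    by (auto simp: differentiable_def dest: Dif_eqI)
qed

lemma differentiable_sgn:
  fixes g :: "'a::real_normed_vector \<Rightarrow> 'b::real_inner"
  assumes "g differentiable at x" "g x \<noteq> 0"
  shows "(\<lambda>y. sgn (g y)) differentiable at x"
  unfolding sgn_div_norm
  using assms differentiable_chain_at[OF assms(1) differentiable_norm_at]
  by (intro differentiable_scaleR differentiable_inverse) (auto simp: o_def)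

text \<open>Openness is essential: it makes equality on \<open>S\<close> pass to the derivatives of \<open>g\<close> and \<open>h\<close> at points of \<open>S\<close>.\<close>

lemma C_k_on_cong:
  assumes "open S" "\<And>x. x \<in> S \<Longrightarrow> g x = h x" "C_k_on n S g"
  shows "C_k_on n S h"
  using assms(2,3)
proof (induction n arbitrary: g h)
  case 0
  then show ?case by (simp cong: continuous_on_cong)
next
  case (Suc n)
  have d: "h differentiable at x" "Dif h x = Dif g x" if "x \<in> S" for x
    using Dif_cong[OF assms(1) that, of g h] Suc.prems that by auto
  have "C_k_on n S (\<lambda>x. Dif h x v)" for v
    using Suc.IH[of "\<lambda>x. Dif g x v" "\<lambda>x. Dif h x v"] Suc.prems(2) d(2) by auto
  then show ?case using d by simp
qed

lemma C_k_on_SucD: "C_k_on (Suc n) S g \<Longrightarrow> C_k_on n S g"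
proof (induction n arbitrary: g)
  case 0
  then show ?case
    by (auto intro!: continuous_at_imp_continuous_on differentiable_imp_continuous_within)
next
  case (Suc n)
  from Suc.prems have "\<forall>x\<in>S. g differentiable at x" "\<And>v. C_k_on (Suc n) S (\<lambda>x. Dif g x v)"
    by (subst (asm) C_k_on.simps(2), blast)+
  then show ?case using Suc.IH by simp
qed

lemma C_k_on_const: "C_k_on n S (\<lambda>x. c)"
  by (induction n arbitrary: c) auto

lemma C_k_on_add:
  assumes "open S" "C_k_on n S g" "C_k_on n S h"
  shows "C_k_on n S (\<lambda>x. g x + h x)"
  using assms(2,3)
proof (induction n arbitrary: g h)
  case 0
  then show ?case by (simp add: continuous_on_add)
next
  case (Suc n)
  have d: "((\<lambda>x. g x + h x) has_derivative (\<lambda>v. Dif g x v + Dif h x v)) (at x)" if "x \<in> S" for x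
    using Suc.prems that by (auto intro!: has_derivative_add differentiable_Dif)
  have "C_k_on n S (\<lambda>x. Dif (\<lambda>x. g x + h x) x v)" for v
    by (rule C_k_on_cong[OF assms(1), of "\<lambda>x. Dif g x v + Dif h x v"])
      (use Suc in \<open>auto simp: Dif_eqI[OF d]\<close>)
  then show ?case using d by (auto simp: differentiable_def)
qed

lemma C_k_on_sum:
  assumes "open S" "finite I" "\<And>i. i \<in> I \<Longrightarrow> C_k_on n S (g i)"
  shows "C_k_on n S (\<lambda>x. \<Sum>i\<in>I. g i x)"
  using assms(2,3)
  by (induction I rule: finite_induct) (auto intro!: C_k_on_const C_k_on_add[OF assms(1)])

lemma C_k_on_bounded_linear:
  assumes "bounded_linear L" "open S" "C_k_on n S g"
  shows "C_k_on n S (\<lambda>x. L (g x))"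
  using assms(3)
proof (induction n arbitrary: g)
  case 0
  then show ?case by (simp add: bounded_linear.continuous_on[OF assms(1)])
next
  case (Suc n)
  have d: "((\<lambda>x. L (g x)) has_derivative (\<lambda>v. L (Dif g x v))) (at x)" if "x \<in> S" for x
    using Suc.prems that by (auto intro!: bounded_linear.has_derivative[OF assms(1)] differentiable_Dif)
  have "C_k_on n S (\<lambda>x. Dif (\<lambda>x. L (g x)) x v)" for v
    by (rule C_k_on_cong[OF assms(2), of "\<lambda>x. L (Dif g x v)"])
      (use Suc in \<open>auto simp: Dif_eqI[OF d]\<close>)
  then show ?case using d by (auto simp: differentiable_def)
qed

lemma C_k_on_scaleR:
  assumes "open S" "C_k_on n S u" "C_k_on n S h"
  shows "C_k_on n S (\<lambda>x. u x *\<^sub>R h x)"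
  using assms(2,3)
proof (induction n arbitrary: u h)
  case 0
  then show ?case by (simp add: continuous_on_scaleR)
next
  case (Suc n)
  have d: "((\<lambda>x. u x *\<^sub>R h x) has_derivative (\<lambda>v. u x *\<^sub>R Dif h x v + Dif u x v *\<^sub>R h x)) (at x)"
    if "x \<in> S" for x
    using Suc.prems that by (auto intro!: has_derivative_scaleR differentiable_Dif)
  have "C_k_on n S (\<lambda>x. Dif (\<lambda>x. u x *\<^sub>R h x) x v)" for v
    by (rule C_k_on_cong[OF assms(1), of "\<lambda>x. u x *\<^sub>R Dif h x v + Dif u x v *\<^sub>R h x"])
      (use Suc.prems Suc.prems[THEN C_k_on_SucD] in \<open>auto simp: Dif_eqI[OF d] intro!: Suc.IH C_k_on_add[OF assms(1)]\<close>)
  then show ?case using d by (auto simp: differentiable_def)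
qed

text \<open>Needed to see that a field defined through one chart is smooth in every other chart, where it is read through a transition map.\<close>

lemma C_k_on_compose:
  fixes \<tau> :: "'a::real_normed_vector \<Rightarrow> 'b::euclidean_space"
  assumes "open S" "C_k_on n S \<tau>" "C_k_on n T g" "\<tau> ` S \<subseteq> T"
  shows "C_k_on n S (\<lambda>x. g (\<tau> x))"
  using assms(2,3)
proof (induction n arbitrary: g)
  case 0
  then show ?case using assms(4) by (auto intro: continuous_on_compose2)
next
  case (Suc n)
  have dg: "g differentiable at (\<tau> x)" if "x \<in> S" for x
    using Suc.prems(2) assms(4) that by auto
  have d: "((\<lambda>x. g (\<tau> x)) has_derivative (\<lambda>v. Dif g (\<tau> x) (Dif \<tau> x v))) (at x)" if "x \<in> S" for x
    using Suc.prems that dg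
    by (auto intro!: has_derivative_compose[where f = \<tau> and g = g, simplified o_def] differentiable_Dif)
  \<comment> \<open>Expanding in a basis separates the two factors of the chain rule, so that products of
    functions of class \<open>C\<^sup>n\<close> remain.\<close>
  have e: "Dif g (\<tau> x) (Dif \<tau> x v) = (\<Sum>i\<in>Basis. (Dif \<tau> x v \<bullet> i) *\<^sub>R Dif g (\<tau> x) i)" if "x \<in> S" for x v
  proof -
    interpret linear "Dif g (\<tau> x)" using linear_frechet_derivative dg that by blast
    have "Dif g (\<tau> x) (\<Sum>i\<in>Basis. (Dif \<tau> x v \<bullet> i) *\<^sub>R i) = (\<Sum>i\<in>Basis. (Dif \<tau> x v \<bullet> i) *\<^sub>R Dif g (\<tau> x) i)"
      by (simp add: sum scale)
    then show ?thesis by (simp add: euclidean_representation)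
  qed
  have "C_k_on n S (\<lambda>x. (Dif \<tau> x v \<bullet> i) *\<^sub>R Dif g (\<tau> x) i)" for i v
    using Suc.prems Suc.IH[OF C_k_on_SucD[OF Suc.prems(1)], of "\<lambda>y. Dif g y i"]
    by (intro C_k_on_scaleR[OF assms(1)]
        C_k_on_bounded_linear[OF bounded_linear_inner_left assms(1)]) auto
  then have "C_k_on n S (\<lambda>x. \<Sum>i\<in>Basis. (Dif \<tau> x v \<bullet> i) *\<^sub>R Dif g (\<tau> x) i)" for v
    by (intro C_k_on_sum[OF assms(1)]) auto
  then have "C_k_on n S (\<lambda>x. Dif (\<lambda>x. g (\<tau> x)) x v)" for v
    by (rule C_k_on_cong[OF assms(1), rotated]) (simp add: Dif_eqI[OF d] e)
  then show ?case using d by (auto simp: differentiable_def)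
qed

text \<open>The mean value theorem, applied first to the difference in the direction \<open>b\<close> as a function
  along \<open>a\<close> and then to its derivative along \<open>b\<close>. The left-hand side of the resulting equation
  is symmetric in \<open>a\<close> and \<open>b\<close>; the right-hand side is a mixed derivative at a point near \<open>p\<close>.\<close>

lemma mixed_difference_quotient:
  fixes \<phi> :: "'a::real_normed_vector \<Rightarrow> real"
  assumes t: "0 < t"
    and S: "\<And>s r. 0 \<le> s \<Longrightarrow> s \<le> t \<Longrightarrow> 0 \<le> r \<Longrightarrow> r \<le> t \<Longrightarrow> p + s *\<^sub>R a + r *\<^sub>R b \<in> S"
    and d1: "\<And>x. x \<in> S \<Longrightarrow> \<phi> differentiable at x"
    and d2: "\<And>x. x \<in> S \<Longrightarrow> (\<lambda>y. Dif \<phi> y a) differentiable at x"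
  obtains s r where "0 \<le> s" "s \<le> t" "0 \<le> r" "r \<le> t"
    "\<phi> (p + t *\<^sub>R a + t *\<^sub>R b) - \<phi> (p + t *\<^sub>R a) - \<phi> (p + t *\<^sub>R b) + \<phi> p
      = t * t * Dif (\<lambda>y. Dif \<phi> y a) (p + s *\<^sub>R a + r *\<^sub>R b) b"
proof -
  have lin1: "Dif \<phi> x (c *\<^sub>R a) = c * Dif \<phi> x a" if "x \<in> S" for x c
    using linear_cmul[OF linear_frechet_derivative[OF d1[OF that]]] by simp
  have lin2: "Dif (\<lambda>y. Dif \<phi> y a) x (c *\<^sub>R b) = c * Dif (\<lambda>y. Dif \<phi> y a) x b" if "x \<in> S" for x c
    using linear_cmul[OF linear_frechet_derivative[OF d2[OF that]]] by simp
  define g where "g s = \<phi> (p + s *\<^sub>R a + t *\<^sub>R b) - \<phi> (p + s *\<^sub>R a)" for s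
  have *: "((\<lambda>s. \<phi> (p + s *\<^sub>R a + r *\<^sub>R b)) has_derivative (\<lambda>c. c * Dif \<phi> (p + s *\<^sub>R a + r *\<^sub>R b) a)) (at s within X)"
    if "0 \<le> s" "s \<le> t" "0 \<le> r" "r \<le> t" for s r X
  proof -
    have x: "p + s *\<^sub>R a + r *\<^sub>R b \<in> S" using S that by blast
    have "((\<lambda>s. p + s *\<^sub>R a + r *\<^sub>R b) has_derivative (\<lambda>c. c *\<^sub>R a)) (at s within X)"
      by (auto intro!: derivative_eq_intros)
    from has_derivative_compose[OF this differentiable_Dif[OF d1[OF x]]]
    show ?thesis by (simp add: lin1[OF x])
  qed
  have "\<exists>s\<in>{0<..<t}. g t - g 0 =
      (\<lambda>s c. c * Dif \<phi> (p + s *\<^sub>R a + t *\<^sub>R b) a - c * Dif \<phi> (p + s *\<^sub>R a) a) s (t - 0)"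
  proof (rule mvt_simple[OF t])
    fix s assume "0 \<le> s" "s \<le> t"
    then show "(g has_derivative (\<lambda>c. c * Dif \<phi> (p + s *\<^sub>R a + t *\<^sub>R b) a - c * Dif \<phi> (p + s *\<^sub>R a) a))
        (at s within {0..t})"
      unfolding g_def using *[of s t] *[of s 0] t by (auto intro!: has_derivative_diff)
  qed
  then obtain s where s: "0 < s" "s < t" and
    1: "g t - g 0 = t * (Dif \<phi> (p + s *\<^sub>R a + t *\<^sub>R b) a - Dif \<phi> (p + s *\<^sub>R a) a)"
    by (auto simp: algebra_simps)
  have "\<exists>r\<in>{0<..<t}. Dif \<phi> (p + s *\<^sub>R a + t *\<^sub>R b) a - Dif \<phi> (p + s *\<^sub>R a + 0 *\<^sub>R b) a =
      (\<lambda>r c. c * Dif (\<lambda>y. Dif \<phi> y a) (p + s *\<^sub>R a + r *\<^sub>R b) b) r (t - 0)"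
  proof (rule mvt_simple[OF t])
    fix r assume "0 \<le> r" "r \<le> t"
    then have x: "p + s *\<^sub>R a + r *\<^sub>R b \<in> S" using S s by simp
    have "((\<lambda>r. p + s *\<^sub>R a + r *\<^sub>R b) has_derivative (\<lambda>c. c *\<^sub>R b)) (at r within {0..t})"
      by (auto intro!: derivative_eq_intros)
    from has_derivative_compose[OF this differentiable_Dif[OF d2[OF x]]]
    show "((\<lambda>r. Dif \<phi> (p + s *\<^sub>R a + r *\<^sub>R b) a) has_derivative
        (\<lambda>c. c * Dif (\<lambda>y. Dif \<phi> y a) (p + s *\<^sub>R a + r *\<^sub>R b) b)) (at r within {0..t})"
      by (simp add: lin2[OF x])
  qed
  then obtain r where r: "0 < r" "r < t" and
    2: "Dif \<phi> (p + s *\<^sub>R a + t *\<^sub>R b) a - Dif \<phi> (p + s *\<^sub>R a) a =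
      t * Dif (\<lambda>y. Dif \<phi> y a) (p + s *\<^sub>R a + r *\<^sub>R b) b"
    by auto
  show ?thesis
    using that[of s r] s r 1 2 by (simp add: g_def algebra_simps)
qed

text \<open>Both orders of differentiation express the same symmetric second difference, so for every small
  \<open>t\<close> the two mixed derivatives agree at points of distance \<open>O(t)\<close> from \<open>p\<close>, though perhaps not at
  the same point. Continuity removes the discrepancy as \<open>t\<close> tends to \<open>0\<close>.\<close>

lemma mixed_derivatives_commute_real:
  fixes \<phi> :: "'a::real_normed_vector \<Rightarrow> real"
  assumes "open S" "p \<in> S" "C_k_on 2 S \<phi>"
  shows "Dif (\<lambda>x. Dif \<phi> x a) p b = Dif (\<lambda>x. Dif \<phi> x b) p a"
proof (rule ccontr)
  let ?A = "\<lambda>x. Dif (\<lambda>x. Dif \<phi> x a) x b" and ?B = "\<lambda>x. Dif (\<lambda>x. Dif \<phi> x b) x a"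
  assume ne: "?A p \<noteq> ?B p"
  have d1: "\<phi> differentiable at x" and d2: "(\<lambda>y. Dif \<phi> y c) differentiable at x" if "x \<in> S" for x c
    using assms(3) that by (auto simp: numeral_2_eq_2)
  define e where "e = \<bar>?A p - ?B p\<bar> / 2"
  have e: "e > 0" using ne by (simp add: e_def)
  have "isCont ?A p" "isCont ?B p"
    using assms by (auto simp: numeral_2_eq_2 continuous_on_eq_continuous_at)
  then obtain \<delta>1 \<delta>2 where \<delta>: "\<delta>1 > 0" "\<delta>2 > 0"
    "\<And>x. dist x p < \<delta>1 \<Longrightarrow> dist (?A x) (?A p) < e" "\<And>x. dist x p < \<delta>2 \<Longrightarrow> dist (?B x) (?B p) < e"
    using e unfolding continuous_at_eps_delta by blast
  obtain \<delta>3 where \<delta>3: "\<delta>3 > 0" "ball p \<delta>3 \<subseteq> S" using assms(1,2) open_contains_ball by blast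
  define \<delta> where "\<delta> = Min {\<delta>1, \<delta>2, \<delta>3}"
  have \<delta>pos: "\<delta> > 0" using \<delta> \<delta>3 by (simp add: \<delta>_def)
  \<comment> \<open>The parallelogram with sides \<open>t a\<close> and \<open>t b\<close> then fits in the ball of radius \<open>\<delta>\<close>;
    the summand \<open>1\<close> covers the case \<open>a = b = 0\<close>.\<close>
  define t where "t = \<delta> / (norm a + norm b + 1)"
  have n: "norm a + norm b + 1 > 0" by (simp add: add_nonneg_pos)
  have t: "t > 0" using \<delta>pos n by (simp add: t_def)
  have near: "dist (p + s *\<^sub>R a + r *\<^sub>R b) p < \<delta>" if "0 \<le> s" "s \<le> t" "0 \<le> r" "r \<le> t" for s r
  proof -
    have "dist (p + s *\<^sub>R a + r *\<^sub>R b) p = norm (s *\<^sub>R a + r *\<^sub>R b)" by (simp add: dist_norm)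
    also have "\<dots> \<le> s * norm a + r * norm b" using norm_triangle_ineq[of "s *\<^sub>R a" "r *\<^sub>R b"] that by simp
    also have "\<dots> \<le> t * norm a + t * norm b" using that by (intro add_mono mult_right_mono) auto
    also have "\<dots> < t * (norm a + norm b + 1)" using t by (simp add: algebra_simps)
    also have "\<dots> = \<delta>" using n by (simp add: t_def)
    finally show ?thesis .
  qed
  have inS: "x \<in> S" if "dist x p < \<delta>" for x
    using that \<delta>3 by (auto simp: \<delta>_def dist_commute)
  obtain s r where sr: "0 \<le> s" "s \<le> t" "0 \<le> r" "r \<le> t"
    "\<phi> (p + t *\<^sub>R a + t *\<^sub>R b) - \<phi> (p + t *\<^sub>R a) - \<phi> (p + t *\<^sub>R b) + \<phi> p
      = t * t * ?A (p + s *\<^sub>R a + r *\<^sub>R b)"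
    by (rule mixed_difference_quotient[OF t, of p a b S \<phi>]) (use near inS d1 d2 in auto)
  obtain s' r' where sr': "0 \<le> s'" "s' \<le> t" "0 \<le> r'" "r' \<le> t"
    "\<phi> (p + t *\<^sub>R b + t *\<^sub>R a) - \<phi> (p + t *\<^sub>R b) - \<phi> (p + t *\<^sub>R a) + \<phi> p
      = t * t * ?B (p + s' *\<^sub>R b + r' *\<^sub>R a)"
  proof (rule mixed_difference_quotient[OF t, of p b a S \<phi>])
    fix s r assume "0 \<le> s" "s \<le> t" "0 \<le> r" "r \<le> t"
    then show "p + s *\<^sub>R b + r *\<^sub>R a \<in> S" using near[of r s] inS by (simp add: algebra_simps)
  qed (use d1 d2 in auto)
  have "t * t * ?A (p + s *\<^sub>R a + r *\<^sub>R b) = t * t * ?B (p + s' *\<^sub>R b + r' *\<^sub>R a)"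
    using sr(5) sr'(5) by (simp add: algebra_simps)
  then have eq: "?A (p + s *\<^sub>R a + r *\<^sub>R b) = ?B (p + s' *\<^sub>R b + r' *\<^sub>R a)" using t by simp
  have "dist (?A (p + s *\<^sub>R a + r *\<^sub>R b)) (?A p) < e"
    using near[OF sr(1-4)] by (intro \<delta>(3)) (simp add: \<delta>_def)
  moreover have "dist (?B (p + s' *\<^sub>R b + r' *\<^sub>R a)) (?B p) < e"
    using near[OF sr'(3,4,1,2)] by (intro \<delta>(4)) (simp add: \<delta>_def algebra_simps)
  ultimately have "\<bar>?A p - ?B p\<bar> < 2 * e" using eq by (simp add: dist_real_def)
  then show False by (simp add: e_def)
qed

lemma mixed_derivatives_commute:
  fixes g :: "'a::real_normed_vector \<Rightarrow> 'b::euclidean_space"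
  assumes "open S" "p \<in> S" "C_k_on 2 S g"
  shows "Dif (\<lambda>x. Dif g x a) p b = Dif (\<lambda>x. Dif g x b) p a"
proof (rule euclidean_eqI)
  fix i :: 'b
  have d1: "g differentiable at x" and d2: "(\<lambda>y. Dif g y c) differentiable at x" if "x \<in> S" for x c
    using assms(3) that by (auto simp: numeral_2_eq_2)
  have inner: "Dif (\<lambda>x. h x \<bullet> i) x c = Dif h x c \<bullet> i" if "h differentiable at x" for h :: "'a \<Rightarrow> 'b" and x c
    using Dif_eqI[OF has_derivative_inner_left[OF differentiable_Dif[OF that]]] by simp
  have twice: "Dif (\<lambda>x. Dif (\<lambda>y. g y \<bullet> i) x c) p d = Dif (\<lambda>x. Dif g x c) p d \<bullet> i" for c d
  proof -
    have "(\<lambda>x. Dif g x c \<bullet> i) differentiable at p"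
      unfolding differentiable_def
      using has_derivative_inner_left[OF differentiable_Dif[OF d2[OF assms(2)]]] by blast
    then have "Dif (\<lambda>x. Dif (\<lambda>y. g y \<bullet> i) x c) p = Dif (\<lambda>x. Dif g x c \<bullet> i) p"
      by (rule Dif_cong(2)[OF assms(1,2), rotated]) (use d1 inner in auto)
    then show ?thesis using inner[OF d2[OF assms(2)]] by simp
  qed
  have "C_k_on 2 S (\<lambda>x. g x \<bullet> i)"
    by (rule C_k_on_bounded_linear[OF bounded_linear_inner_left assms(1,3)])
  from mixed_derivatives_commute_real[OF assms(1,2) this]
  show "Dif (\<lambda>x. Dif g x a) p b \<bullet> i = Dif (\<lambda>x. Dif g x b) p a \<bullet> i" by (simp add: twice)
qed


section \<open>Linear algebra of planes in space\<close>

lemma linear_vec2: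
  assumes "linear (L :: real^2 \<Rightarrow> 'b::real_vector)"
  shows "L a = (a $ 1) *\<^sub>R L (axis 1 1) + (a $ 2) *\<^sub>R L (axis 2 1)"
proof -
  have "a = (a $ 1) *\<^sub>R axis 1 1 + (a $ 2) *\<^sub>R axis 2 1"
    by (simp add: vec_eq_iff forall_2 axis_def)
  then show ?thesis using linear_add[OF assms] linear_cmul[OF assms] by metis
qed

text \<open>The normal direction given by a chart changes by the Jacobian determinant of the transition map, so its sign is fixed by the orientation.\<close>

lemma cross3_linear_image:
  fixes L :: "real^2 \<Rightarrow> real^3"
  assumes L: "linear L" and T: "linear T"
  shows "cross3 (L (T (axis 1 1))) (L (T (axis 2 1)))
    = det (matrix T) *\<^sub>R cross3 (L (axis 1 1)) (L (axis 2 1))"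
proof -
  have "cross3 (L (T (axis 1 1))) (L (T (axis 2 1)))
    = (T (axis 1 1) $ 1 * T (axis 2 1) $ 2) *\<^sub>R cross3 (L (axis 1 1)) (L (axis 2 1))
      + (T (axis 1 1) $ 2 * T (axis 2 1) $ 1) *\<^sub>R cross3 (L (axis 2 1)) (L (axis 1 1))"
    by (simp add: linear_vec2[OF L, of "T _"] cross_add_left cross_add_right cross_mult_left cross_mult_right mult.commute)
  also have "\<dots> = det (matrix T) *\<^sub>R cross3 (L (axis 1 1)) (L (axis 2 1))"
    by (subst (2) cross_skew) (simp add: det_2 matrix_def algebra_simps)
  finally show ?thesis .
qed

lemma cross3_linear_nonzero:
  fixes L :: "real^2 \<Rightarrow> real^3"
  assumes "linear L" "inj L"
  shows "cross3 (L (axis 1 1)) (L (axis 2 1)) \<noteq> 0"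
proof
  assume "cross3 (L (axis 1 1)) (L (axis 2 1)) = 0"
  then consider "L (axis 1 1) = 0" | "L (axis 2 1) = 0" | c where "L (axis 2 1) = c *\<^sub>R L (axis 1 1)"
    unfolding cross_eq_0 collinear_lemma by blast
  then show False
  proof cases
    case (3 c)
    then have "L (axis 2 1) = L (c *\<^sub>R axis 1 1)" using linear_cmul[OF assms(1)] by simp
    then have "axis 2 1 = c *\<^sub>R (axis 1 1 :: real^2)" using assms(2) by (simp add: inj_eq)
    then show False by (simp add: vec_eq_iff forall_2 axis_def)
  qed (use assms linear_injective_0[OF assms(1)] in \<open>auto\<close>)
qed

text \<open>With \<open>c = a \<times> b\<close> one has \<open>c \<times> (x \<times> c) = (c \<bullet> c) x - (x \<bullet> c) c\<close>, whereas \<open>(a \<times> b) \<times> u\<close> is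
  always a combination of \<open>a\<close> and \<open>b\<close>. For \<open>x\<close> orthogonal to \<open>c\<close> this expresses \<open>x\<close> explicitly.\<close>

lemma orthogonal_cross3_combination:
  fixes a b x :: "real^3"
  assumes "cross3 a b \<noteq> 0" "x \<bullet> cross3 a b = 0"
  obtains s r where "x = s *\<^sub>R a + r *\<^sub>R b"
proof -
  let ?c = "cross3 a b"
  have 1: "cross3 ?c (cross3 x ?c) = (?c \<bullet> ?c) *\<^sub>R x - (x \<bullet> ?c) *\<^sub>R ?c"
    using exhaust_3 by (force simp add: cross3_simps)
  have 2: "cross3 ?c u = (a \<bullet> u) *\<^sub>R b - (b \<bullet> u) *\<^sub>R a" for u
    using exhaust_3 by (force simp add: cross3_simps)
  let ?u = "cross3 x ?c"
  have "(?c \<bullet> ?c) *\<^sub>R x = (a \<bullet> ?u) *\<^sub>R b - (b \<bullet> ?u) *\<^sub>R a"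
    using 1 2[of ?u] assms(2) by simp
  then have "x = (1 / (?c \<bullet> ?c)) *\<^sub>R ((a \<bullet> ?u) *\<^sub>R b - (b \<bullet> ?u) *\<^sub>R a)"
    using assms(1) by (simp flip: \<open>(?c \<bullet> ?c) *\<^sub>R x = _\<close>)
  then have "x = (- (b \<bullet> ?u) / (?c \<bullet> ?c)) *\<^sub>R a + ((a \<bullet> ?u) / (?c \<bullet> ?c)) *\<^sub>R b"
    by (simp add: scaleR_diff_right)
  then show ?thesis by (rule that)
qed

lemma orthonormal_basis_expansion:
  assumes "orthonormal_basis_of T t1 t2" "x \<in> T"
  shows "x = (x \<bullet> t1) *\<^sub>R t1 + (x \<bullet> t2) *\<^sub>R t2"
proof -
  have t: "t1 \<bullet> t1 = 1" "t2 \<bullet> t2 = 1" "t1 \<bullet> t2 = 0" "t2 \<bullet> t1 = 0"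
    using assms(1) by (auto simp: orthonormal_basis_of_def orthogonal_def dot_square_norm inner_commute)
  obtain c d where "x = c *\<^sub>R t1 + d *\<^sub>R t2"
    using assms by (auto simp: orthonormal_basis_of_def span_insert span_singleton) (metis add.commute diff_add_cancel)
  then show ?thesis by (simp add: inner_add_left t)
qed

text \<open>In a plane, being parallel to a unit vector means being orthogonal to that vector turned by a
  right angle. Applied to \<open>x = S v\<close>, this turns the eigenvector equation of a principal direction
  into the vanishing of one scalar.\<close>

lemma eigenvector_iff_orthogonal_to_rotation:
  assumes T: "orthonormal_basis_of T t1 t2" "x \<in> T"
  shows "(\<exists>k. x = k *\<^sub>R unit_direction t1 t2 \<theta>) \<longleftrightarrow> x \<bullet> unit_direction t1 t2 (\<theta> + pi / 2) = 0"
proof -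
  have t: "t1 \<bullet> t1 = 1" "t2 \<bullet> t2 = 1" "t1 \<bullet> t2 = 0" "t2 \<bullet> t1 = 0"
    using assms(1) by (auto simp: orthonormal_basis_of_def orthogonal_def dot_square_norm inner_commute)
  let ?\<alpha> = "x \<bullet> t1" and ?\<beta> = "x \<bullet> t2"
  have rot: "unit_direction t1 t2 (\<theta> + pi / 2) = (- sin \<theta>) *\<^sub>R t1 + cos \<theta> *\<^sub>R t2"
    by (simp add: unit_direction_def cos_add sin_add)
  show ?thesis
  proof
    assume "\<exists>k. x = k *\<^sub>R unit_direction t1 t2 \<theta>"
    then show "x \<bullet> unit_direction t1 t2 (\<theta> + pi / 2) = 0"
      unfolding rot by (auto simp: unit_direction_def inner_add_left inner_add_right inner_diff_right t)
  next
    assume "x \<bullet> unit_direction t1 t2 (\<theta> + pi / 2) = 0"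
    then have o: "?\<beta> * cos \<theta> = ?\<alpha> * sin \<theta>" unfolding rot by (simp add: inner_add_right inner_diff_right algebra_simps)
    have sc: "sin \<theta> * sin \<theta> + cos \<theta> * cos \<theta> = 1" using sin_cos_squared_add[of \<theta>] by (simp add: power2_eq_square)
    let ?k = "?\<alpha> * cos \<theta> + ?\<beta> * sin \<theta>"
    have "?k * cos \<theta> = ?\<alpha>" "?k * sin \<theta> = ?\<beta>"
      using o sc by algebra+
    then have "x = ?k *\<^sub>R unit_direction t1 t2 \<theta>"
      by (subst orthonormal_basis_expansion[OF T]) (simp add: unit_direction_def scaleR_add_right)
    then show "\<exists>k. x = k *\<^sub>R unit_direction t1 t2 \<theta>" by blast
  qed
qed


section \<open>Tangent plane and unit normal in a chart\<close>

locale oriented_immersed_surface =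
  fixes M :: "'a topology" and A :: "'a param set" and f :: "'a \<Rightarrow> real^3"
  assumes oriented: "oriented_surface M A" and immersed: "immersion M A f"
begin

lemma
  assumes "(W, \<psi>) \<in> A"
  shows chart_open: "open W" and chart_image_open: "openin M (\<psi> ` W)" and chart_inj: "inj_on \<psi> W"
    and chart_continuous: "continuous_map (top_of_set W) M \<psi>"
proof -
  have *: "local_param M (W, \<psi>)"
    using oriented assms by (auto simp: oriented_surface_def smooth_surface_def)
  then show "open W" "openin M (\<psi> ` W)" by (auto simp: local_param_def)
  have h: "homeomorphic_map (top_of_set W) (subtopology M (\<psi> ` W)) \<psi>"
    using * by (simp add: local_param_def)
  then show "inj_on \<psi> W" by (simp add: homeomorphic_map_def)
  show "continuous_map (top_of_set W) M \<psi>"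
    using homeomorphic_imp_continuous_map[OF h] continuous_map_into_fulltopology by blast
qed

lemma chart_in_topspace: "(W, \<psi>) \<in> A \<Longrightarrow> p \<in> W \<Longrightarrow> \<psi> p \<in> topspace M"
  using chart_image_open openin_subset by blast

lemma chart_preimage_open:
  assumes "(W, \<psi>) \<in> A" "openin M U"
  shows "open (W \<inter> \<psi> -` U)"
proof -
  have "openin (top_of_set W) {x \<in> W. \<psi> x \<in> U}"
    using openin_continuous_map_preimage[OF chart_continuous[OF assms(1)] assms(2)] by simp
  moreover have "{x \<in> W. \<psi> x \<in> U} = W \<inter> \<psi> -` U" by auto
  ultimately show ?thesis using chart_open[OF assms(1)] by (simp add: openin_open_eq)
qed

lemma transition_smooth:
  assumes "(W, \<psi>) \<in> A" "(V, \<phi>) \<in> A"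
  shows "smooth_on (W \<inter> \<psi> -` (\<phi> ` V)) (inv_into V \<phi> \<circ> \<psi>)"
proof -
  have "\<forall>(W, \<psi>)\<in>A. \<forall>(V, \<phi>)\<in>A. smooth_on (W \<inter> \<psi> -` (\<phi> ` V)) (inv_into V \<phi> \<circ> \<psi>)"
    using oriented by (simp add: oriented_surface_def smooth_surface_def)
  then show ?thesis using assms by blast
qed

lemma immersion_smooth:
  assumes "(W, \<psi>) \<in> A"
  shows "smooth_on W (f \<circ> \<psi>)"
proof -
  have "W \<inter> \<psi> -` topspace M = W" using chart_in_topspace[OF assms] by auto
  moreover have "smooth_on (W \<inter> \<psi> -` topspace M) (f \<circ> \<psi>)"
    using immersed assms unfolding immersion_def smooth_map_on_def by blast
  ultimately show ?thesis by simp
qed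

lemma immersion_differentiable:
  assumes "(W, \<psi>) \<in> A" "p \<in> W"
  shows "(f \<circ> \<psi>) differentiable at p" "(\<lambda>x. Dif (f \<circ> \<psi>) x a) differentiable at p"
proof -
  have "C_k_on (Suc (Suc 0)) W (f \<circ> \<psi>)"
    using immersion_smooth[OF assms(1)] unfolding smooth_on_def by blast
  then show "(f \<circ> \<psi>) differentiable at p" "(\<lambda>x. Dif (f \<circ> \<psi>) x a) differentiable at p"
    using assms(2) by auto
qed

lemma differential_linear: "(W, \<psi>) \<in> A \<Longrightarrow> p \<in> W \<Longrightarrow> linear (Dif (f \<circ> \<psi>) p)"
  using immersion_differentiable(1) linear_frechet_derivative by blast

lemma differential_inj: "(W, \<psi>) \<in> A \<Longrightarrow> p \<in> W \<Longrightarrow> inj (Dif (f \<circ> \<psi>) p)"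
  using immersed unfolding immersion_def by blast

text \<open>The differential \<open>T\<close> of the transition map is chosen before \<open>g\<close>: one \<open>T\<close> serves both the
  immersion and a field along it. Every definition by a chart is therefore consistent.\<close>

lemma chart_change:
  assumes "(W, \<psi>) \<in> A" "p \<in> W" "(V, \<phi>) \<in> A" "q \<in> V" "\<phi> q = \<psi> p"
  obtains T where "linear T" "det (matrix T) > 0"
    "\<And>g :: 'a \<Rightarrow> real^3. (g \<circ> \<phi>) differentiable at q \<Longrightarrow> Dif (g \<circ> \<psi>) p = Dif (g \<circ> \<phi>) q \<circ> T"
proof -
  let ?S = "W \<inter> \<psi> -` (\<phi> ` V)" and ?\<tau> = "inv_into V \<phi> \<circ> \<psi>"
  have S: "open ?S" "p \<in> ?S"
    using chart_preimage_open[OF assms(1) chart_image_open[OF assms(3)]] assms(2,4,5)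
    by (auto simp: image_iff) metis
  have \<tau>p: "?\<tau> p = q"
    using chart_inj[OF assms(3)] assms(4,5) by (metis comp_apply inv_into_f_f)
  have "C_k_on (Suc 0) ?S ?\<tau>"
    using transition_smooth[OF assms(1,3)] unfolding smooth_on_def by blast
  then have d: "?\<tau> differentiable at p" using S by simp
  have "det (matrix (Dif ?\<tau> p)) > 0"
    using oriented assms(1,3) S(2) unfolding oriented_surface_def by blast
  moreover have "Dif (g \<circ> \<psi>) p = Dif (g \<circ> \<phi>) q \<circ> Dif ?\<tau> p"
    if g: "(g \<circ> \<phi>) differentiable at q" for g :: "'a \<Rightarrow> real^3"
  proof -
    have c: "((g \<circ> \<phi>) \<circ> ?\<tau> has_derivative Dif (g \<circ> \<phi>) q \<circ> Dif ?\<tau> p) (at p)"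
      using diff_chain_at[OF differentiable_Dif[OF d], of "g \<circ> \<phi>"] differentiable_Dif[OF g] \<tau>p by simp
    have "(g \<circ> \<psi> has_derivative Dif (g \<circ> \<phi>) q \<circ> Dif ?\<tau> p) (at p)"
      by (rule has_derivative_transform_within_open[OF c S]) (auto simp: f_inv_into_f)
    then show ?thesis by (rule Dif_eqI)
  qed
  ultimately show ?thesis using that linear_frechet_derivative[OF d] by blast
qed

lemma tangent_space_chart:
  assumes "(W, \<psi>) \<in> A" "p \<in> W"
  shows "tangent_space A f (\<psi> p) = range (Dif (f \<circ> \<psi>) p)"
proof
  show "range (Dif (f \<circ> \<psi>) p) \<subseteq> tangent_space A f (\<psi> p)"
    using assms unfolding tangent_space_def by blast
  show "tangent_space A f (\<psi> p) \<subseteq> range (Dif (f \<circ> \<psi>) p)"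
  proof
    fix x assume "x \<in> tangent_space A f (\<psi> p)"
    then obtain V \<phi> q a where q: "(V, \<phi>) \<in> A" "q \<in> V" "\<phi> q = \<psi> p" "x = Dif (f \<circ> \<phi>) q a"
      unfolding tangent_space_def by blast
    obtain T where "Dif (f \<circ> \<phi>) q = Dif (f \<circ> \<psi>) p \<circ> T"
      using chart_change[OF q(1,2) assms q(3)[symmetric]] immersion_differentiable(1)[OF assms] by metis
    then show "x \<in> range (Dif (f \<circ> \<psi>) p)" using q(4) by auto
  qed
qed

lemma unit_normal_chart:
  assumes "(W, \<psi>) \<in> A" "p \<in> W"
  shows "unit_normal A f (\<psi> p) = sgn (cross3 (Dif (f \<circ> \<psi>) p (axis 1 1)) (Dif (f \<circ> \<psi>) p (axis 2 1)))"
  unfolding unit_normal_def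
proof (rule the_equality)
  fix n
  assume "\<exists>(V, \<phi>)\<in>A. \<exists>q\<in>V. \<phi> q = \<psi> p \<and>
      n = sgn (cross3 (Dif (f \<circ> \<phi>) q (axis 1 1)) (Dif (f \<circ> \<phi>) q (axis 2 1)))"
  then obtain V \<phi> q where q: "(V, \<phi>) \<in> A" "q \<in> V" "\<phi> q = \<psi> p"
      "n = sgn (cross3 (Dif (f \<circ> \<phi>) q (axis 1 1)) (Dif (f \<circ> \<phi>) q (axis 2 1)))"
    by blast
  obtain T where T: "linear T" "det (matrix T) > 0" "Dif (f \<circ> \<phi>) q = Dif (f \<circ> \<psi>) p \<circ> T"
    using chart_change[OF q(1,2) assms q(3)[symmetric]] immersion_differentiable(1)[OF assms] by metis
  show "n = sgn (cross3 (Dif (f \<circ> \<psi>) p (axis 1 1)) (Dif (f \<circ> \<psi>) p (axis 2 1)))"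
    using T(2) unfolding q(4) T(3) o_apply cross3_linear_image[OF differential_linear[OF assms] T(1)]
    by (simp add: sgn_scaleR)
qed (rule bexI[OF _ assms(1)], unfold prod.case, rule bexI[OF _ assms(2)], simp)

lemma directional_deriv_chart:
  assumes "(W, \<psi>) \<in> A" "p \<in> W" "(g \<circ> \<psi>) differentiable at p"
  shows "directional_deriv A f (\<psi> p) (Dif (f \<circ> \<psi>) p a) g = Dif (g \<circ> \<psi>) p a"
  unfolding directional_deriv_def
proof (rule the_equality)
  fix w
  assume "\<exists>(V, \<phi>)\<in>A. \<exists>q\<in>V. \<phi> q = \<psi> p \<and>
      (\<exists>b. Dif (f \<circ> \<psi>) p a = Dif (f \<circ> \<phi>) q b \<and> w = Dif (g \<circ> \<phi>) q b)"
  then obtain V \<phi> q b where q: "(V, \<phi>) \<in> A" "q \<in> V" "\<phi> q = \<psi> p"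
      "Dif (f \<circ> \<psi>) p a = Dif (f \<circ> \<phi>) q b" "w = Dif (g \<circ> \<phi>) q b"
    by blast
  obtain T where T: "Dif (f \<circ> \<phi>) q = Dif (f \<circ> \<psi>) p \<circ> T" "Dif (g \<circ> \<phi>) q = Dif (g \<circ> \<psi>) p \<circ> T"
    using chart_change[OF q(1,2) assms(1,2) q(3)[symmetric]] immersion_differentiable(1)[OF assms(1,2)] assms(3)
    by metis
  have "a = T b" using q(4) differential_inj[OF assms(1,2)] T(1) by (simp add: inj_eq)
  then show "w = Dif (g \<circ> \<psi>) p a" using q(5) T(2) by simp
qed (rule bexI[OF _ assms(1)], unfold prod.case, rule bexI[OF _ assms(2)], blast)

abbreviation N where "N \<equiv> unit_normal A f"

lemma unit_normal_differentiable:
  assumes "(W, \<psi>) \<in> A" "p \<in> W"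
  shows "(N \<circ> \<psi>) differentiable at p"
proof -
  have "(\<lambda>x. cross3 (Dif (f \<circ> \<psi>) x (axis 1 1)) (Dif (f \<circ> \<psi>) x (axis 2 1))) differentiable at p"
    unfolding differentiable_def
    using bounded_bilinear.FDERIV[OF bilinear_cross[unfolded bilinear_conv_bounded_bilinear]
        immersion_differentiable(2)[OF assms, THEN differentiable_Dif]
        immersion_differentiable(2)[OF assms, THEN differentiable_Dif]]
    by blast
  from differentiable_sgn[OF this] cross3_linear_nonzero[OF differential_linear differential_inj] assms
  have "(\<lambda>x. sgn (cross3 (Dif (f \<circ> \<psi>) x (axis 1 1)) (Dif (f \<circ> \<psi>) x (axis 2 1)))) differentiable at p"
    by blast
  then show ?thesis
    by (rule Dif_cong(1)[OF chart_open[OF assms(1)] assms(2), rotated])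
      (simp add: unit_normal_chart[OF assms(1)])
qed

lemma norm_unit_normal:
  assumes "(W, \<psi>) \<in> A" "p \<in> W"
  shows "norm (N (\<psi> p)) = 1"
  using cross3_linear_nonzero[OF differential_linear differential_inj] assms
  by (simp add: unit_normal_chart norm_sgn)

text \<open>This form of the tangent space mentions no chart and reduces tangency to an equation that can
  be differentiated along the surface.\<close>

lemma tangent_space_orthogonal:
  assumes "(W, \<psi>) \<in> A" "p \<in> W"
  shows "tangent_space A f (\<psi> p) = {x. x \<bullet> N (\<psi> p) = 0}"
proof -
  let ?D = "Dif (f \<circ> \<psi>) p"
  let ?c = "cross3 (?D (axis 1 1)) (?D (axis 2 1))"
  have lin: "linear ?D" by (rule differential_linear[OF assms])
  have c: "?c \<noteq> 0" by (rule cross3_linear_nonzero[OF lin differential_inj[OF assms]])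
  have N: "x \<bullet> N (\<psi> p) = 0 \<longleftrightarrow> x \<bullet> ?c = 0" for x
    using c by (simp add: unit_normal_chart[OF assms] sgn_div_norm)
  have "?D a \<bullet> ?c = 0" for a
    by (subst linear_vec2[OF lin]) (simp add: inner_add_left dot_cross_self)
  moreover have "x \<in> range ?D" if x: "x \<bullet> ?c = 0" for x
  proof -
    obtain s r where "x = s *\<^sub>R ?D (axis 1 1) + r *\<^sub>R ?D (axis 2 1)"
      using orthogonal_cross3_combination[OF c x] .
    then have "x = ?D (s *\<^sub>R axis 1 1 + r *\<^sub>R axis 2 1)"
      using linear_add[OF lin] linear_cmul[OF lin] by simp
    then show ?thesis by blast
  qed
  ultimately show ?thesis unfolding tangent_space_chart[OF assms] N by auto
qed


section \<open>Second fundamental form and shape operator\<close>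

lemma point_in_chart:
  assumes "m \<in> topspace M"
  obtains W \<psi> p where "(W, \<psi>) \<in> A" "p \<in> W" "m = \<psi> p"
proof -
  have "topspace M = (\<Union>(W, \<psi>)\<in>A. \<psi> ` W)"
    using oriented by (simp add: oriented_surface_def smooth_surface_def)
  then show ?thesis using assms that by blast
qed

lemma unit_normal_inner_self:
  assumes "m \<in> topspace M"
  shows "N m \<bullet> N m = 1"
proof -
  obtain W \<psi> p where p: "(W, \<psi>) \<in> A" "p \<in> W" "m = \<psi> p" using point_in_chart[OF assms] .
  then show ?thesis using norm_unit_normal[OF p(1,2)] by (simp add: dot_square_norm)
qed

lemma normal_component_eq:
  assumes "m \<in> topspace M"
  shows "normal_component A f m w = (w \<bullet> N m) *\<^sub>R N m"
proof -
  obtain W \<psi> p where p: "(W, \<psi>) \<in> A" "p \<in> W" "m = \<psi> p" using point_in_chart[OF assms] .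
  have T: "x \<in> tangent_space A f m \<longleftrightarrow> x \<bullet> N m = 0" for x
    using tangent_space_orthogonal[OF p(1,2)] p(3) by simp
  have N1: "N m \<bullet> N m = 1" by (rule unit_normal_inner_self[OF assms])
  show ?thesis unfolding normal_component_def
  proof (rule the_equality)
    fix n assume n: "(\<forall>x\<in>tangent_space A f m. orthogonal n x) \<and> w - n \<in> tangent_space A f m"
    let ?d = "n - (w \<bullet> N m) *\<^sub>R N m"
    have d: "?d \<bullet> N m = 0" using n N1 by (simp add: T inner_diff_left)
    then have "n \<bullet> ?d = 0" using n T by (simp add: orthogonal_def)
    then have "?d \<bullet> ?d = 0" using d by (simp add: inner_diff_left inner_commute)
    then show "n = (w \<bullet> N m) *\<^sub>R N m" by simp
  qed (use T N1 in \<open>auto simp: orthogonal_def inner_diff_left inner_diff_right inner_commute\<close>)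
qed

text \<open>The field \<open>\<partial>\<^sub>b(f \<circ> \<psi>)\<close> transported to the surface. Such fields extend every tangent vector at a
  point, and their derivatives are second derivatives of \<open>f \<circ> \<psi>\<close>.\<close>

definition coordinate_field :: "(real^2) set \<Rightarrow> (real^2 \<Rightarrow> 'a) \<Rightarrow> real^2 \<Rightarrow> 'a \<Rightarrow> real^3" where
  "coordinate_field W \<psi> b q = Dif (f \<circ> \<psi>) (inv_into W \<psi> q) b"

lemma coordinate_field_chart:
  assumes "(W, \<psi>) \<in> A" "x \<in> W"
  shows "coordinate_field W \<psi> b (\<psi> x) = Dif (f \<circ> \<psi>) x b"
  using chart_inj[OF assms(1)] assms(2) by (simp add: coordinate_field_def)

lemma coordinate_field_tangent:
  assumes "(W, \<psi>) \<in> A"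
  shows "tangent_field_on A f (\<psi> ` W) (coordinate_field W \<psi> b)"
proof -
  have "smooth_on (V \<inter> \<phi> -` (\<psi> ` W)) (coordinate_field W \<psi> b \<circ> \<phi>)" if V: "(V, \<phi>) \<in> A" for V \<phi>
    unfolding smooth_on_def
  proof
    fix n
    have F: "C_k_on (Suc n) W (f \<circ> \<psi>)"
      using immersion_smooth[OF assms] unfolding smooth_on_def by blast
    have "C_k_on n (V \<inter> \<phi> -` (\<psi> ` W)) (\<lambda>x. Dif (f \<circ> \<psi>) ((inv_into W \<psi> \<circ> \<phi>) x) b)"
    proof (rule C_k_on_compose[where T = W and g = "\<lambda>y. Dif (f \<circ> \<psi>) y b"])
      show "open (V \<inter> \<phi> -` (\<psi> ` W))"
        by (rule chart_preimage_open[OF V chart_image_open[OF assms]])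
      show "C_k_on n (V \<inter> \<phi> -` (\<psi> ` W)) (inv_into W \<psi> \<circ> \<phi>)"
        using transition_smooth[OF V assms] unfolding smooth_on_def by blast
      show "C_k_on n W (\<lambda>y. Dif (f \<circ> \<psi>) y b)" using F by simp
      show "(inv_into W \<psi> \<circ> \<phi>) ` (V \<inter> \<phi> -` (\<psi> ` W)) \<subseteq> W" by (auto intro: inv_into_into)
    qed
    then show "C_k_on n (V \<inter> \<phi> -` (\<psi> ` W)) (coordinate_field W \<psi> b \<circ> \<phi>)"
      by (simp add: coordinate_field_def o_def)
  qed
  moreover have "coordinate_field W \<psi> b q \<in> tangent_space A f q" if "q \<in> \<psi> ` W" for q
    using that assms tangent_space_chart coordinate_field_chart by auto
  ultimately show ?thesis unfolding tangent_field_on_def smooth_map_on_def by blast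
qed

lemma tangent_field_differentiable:
  assumes "(W, \<psi>) \<in> A" "p \<in> W" "openin M U" "\<psi> p \<in> U" "tangent_field_on A f U Y"
  shows "(Y \<circ> \<psi>) differentiable at p"
proof -
  have "smooth_on (W \<inter> \<psi> -` U) (Y \<circ> \<psi>)"
    using assms(1,5) unfolding tangent_field_on_def smooth_map_on_def by blast
  then have "C_k_on (Suc 0) (W \<inter> \<psi> -` U) (Y \<circ> \<psi>)" unfolding smooth_on_def by blast
  then show ?thesis using assms by simp
qed

lemma shape_operator_chart:
  assumes "(W, \<psi>) \<in> A" "p \<in> W"
  shows "shape_operator A f (\<psi> p) (Dif (f \<circ> \<psi>) p a) = - Dif (N \<circ> \<psi>) p a"
  unfolding shape_operator_def
  using directional_deriv_chart[OF assms unit_normal_differentiable[OF assms]] by simp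

text \<open>Differentiate \<open>Y \<bullet> N = 0\<close> along \<open>X\<close>. The right-hand side depends on \<open>Y\<close> only through \<open>Y m\<close>, which
  is what makes the second fundamental form well defined.\<close>

lemma weingarten:
  assumes "openin M U" "m \<in> U" "tangent_field_on A f U Y" "X \<in> tangent_space A f m"
  shows "directional_deriv A f m X Y \<bullet> N m = shape_operator A f m X \<bullet> Y m"
proof -
  have "m \<in> topspace M" using assms(1,2) openin_subset by blast
  then obtain W \<psi> p where p: "(W, \<psi>) \<in> A" "p \<in> W" "m = \<psi> p" using point_in_chart by metis
  obtain a where a: "X = Dif (f \<circ> \<psi>) p a"
    using assms(4) tangent_space_chart[OF p(1,2)] p(3) by auto
  let ?S = "W \<inter> \<psi> -` U"
  have S: "open ?S" "p \<in> ?S" using chart_preimage_open[OF p(1) assms(1)] p assms(2) by auto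
  have dY: "(Y \<circ> \<psi>) differentiable at p"
    using tangent_field_differentiable[OF p(1,2) assms(1) _ assms(3)] assms(2) p(3) by simp
  have dN: "(N \<circ> \<psi>) differentiable at p" by (rule unit_normal_differentiable[OF p(1,2)])
  have zero: "(Y \<circ> \<psi>) x \<bullet> (N \<circ> \<psi>) x = 0" if "x \<in> ?S" for x
    using that assms(3) tangent_space_orthogonal[OF p(1), of x] unfolding tangent_field_on_def by auto
  have "((\<lambda>x. (Y \<circ> \<psi>) x \<bullet> (N \<circ> \<psi>) x) has_derivative
      (\<lambda>v. (Y \<circ> \<psi>) p \<bullet> Dif (N \<circ> \<psi>) p v + Dif (Y \<circ> \<psi>) p v \<bullet> (N \<circ> \<psi>) p)) (at p)"
    by (rule has_derivative_inner[OF differentiable_Dif[OF dY] differentiable_Dif[OF dN]])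
  from has_derivative_transform_within_open[OF this S zero]
  have "((\<lambda>x. 0) has_derivative
      (\<lambda>v. (Y \<circ> \<psi>) p \<bullet> Dif (N \<circ> \<psi>) p v + Dif (Y \<circ> \<psi>) p v \<bullet> (N \<circ> \<psi>) p)) (at p)" by simp
  from has_derivative_unique[OF this has_derivative_const]
  have "Y m \<bullet> Dif (N \<circ> \<psi>) p a + Dif (Y \<circ> \<psi>) p a \<bullet> N m = 0"
    unfolding p(3) by (metis comp_apply)
  then show ?thesis
    using directional_deriv_chart[OF p(1,2) dY, of a] shape_operator_chart[OF p(1,2), of a]
    by (simp add: a p(3) inner_commute)
qed

lemma second_fundamental_form_eq:
  assumes m: "m \<in> topspace M" and X: "X \<in> tangent_space A f m" and y: "y \<in> tangent_space A f m"
  shows "second_fundamental_form M A f m X y = (shape_operator A f m X \<bullet> y) *\<^sub>R N m"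
  unfolding second_fundamental_form_def
proof (rule the_equality)
  have extension: "normal_component A f m (directional_deriv A f m X Y) = (shape_operator A f m X \<bullet> y) *\<^sub>R N m"
    if "openin M U" "m \<in> U" "tangent_field_on A f U Y" "Y m = y" for U Y
    using weingarten[OF that(1-3) X] that(4) normal_component_eq[OF m] by simp
  show "w = (shape_operator A f m X \<bullet> y) *\<^sub>R N m"
    if "\<exists>U Y. openin M U \<and> m \<in> U \<and> tangent_field_on A f U Y \<and> Y m = y \<and>
      w = normal_component A f m (directional_deriv A f m X Y)" for w
    using that extension by blast
  obtain W \<psi> p where p: "(W, \<psi>) \<in> A" "p \<in> W" "m = \<psi> p" using point_in_chart[OF m] .
  obtain b where b: "y = Dif (f \<circ> \<psi>) p b"
    using y tangent_space_chart[OF p(1,2)] p(3) by auto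
  have "openin M (\<psi> ` W)" "m \<in> \<psi> ` W" "tangent_field_on A f (\<psi> ` W) (coordinate_field W \<psi> b)"
    "coordinate_field W \<psi> b m = y"
    using chart_image_open[OF p(1)] p coordinate_field_tangent[OF p(1)] coordinate_field_chart[OF p(1,2)] b
    by auto
  with extension[OF this] show "\<exists>U Y. openin M U \<and> m \<in> U \<and> tangent_field_on A f U Y \<and> Y m = y \<and>
      (shape_operator A f m X \<bullet> y) *\<^sub>R N m = normal_component A f m (directional_deriv A f m X Y)"
    by metis
qed

text \<open>For coordinate fields, the Weingarten equation expresses \<open>S X \<bullet> y\<close> as the normal part of a mixed
  second derivative of \<open>f \<circ> \<psi>\<close>, and mixed derivatives commute.\<close>

lemma shape_operator_symmetric:
  assumes m: "m \<in> topspace M" and X: "X \<in> tangent_space A f m" and y: "y \<in> tangent_space A f m"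
  shows "shape_operator A f m X \<bullet> y = shape_operator A f m y \<bullet> X"
proof -
  obtain W \<psi> p where p: "(W, \<psi>) \<in> A" "p \<in> W" "m = \<psi> p" using point_in_chart[OF m] .
  obtain a b where ab: "X = Dif (f \<circ> \<psi>) p a" "y = Dif (f \<circ> \<psi>) p b"
    using X y tangent_space_chart[OF p(1,2)] p(3) by auto
  have *: "shape_operator A f m (Dif (f \<circ> \<psi>) p a) \<bullet> Dif (f \<circ> \<psi>) p b
    = Dif (\<lambda>x. Dif (f \<circ> \<psi>) x b) p a \<bullet> N m" for a b
  proof -
    let ?Y = "coordinate_field W \<psi> b"
    have U: "openin M (\<psi> ` W)" "m \<in> \<psi> ` W" "tangent_field_on A f (\<psi> ` W) ?Y" "\<psi> p \<in> \<psi> ` W"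
      using chart_image_open[OF p(1)] p coordinate_field_tangent[OF p(1)] by auto
    have dY: "(?Y \<circ> \<psi>) differentiable at p"
      by (rule tangent_field_differentiable[OF p(1,2) U(1,4,3)])
    have "Dif (\<lambda>x. Dif (f \<circ> \<psi>) x b) p = Dif (?Y \<circ> \<psi>) p"
      by (rule Dif_cong(2)[OF chart_open[OF p(1)] p(2) _ dY]) (simp add: coordinate_field_chart[OF p(1)])
    moreover have "directional_deriv A f m (Dif (f \<circ> \<psi>) p a) ?Y = Dif (?Y \<circ> \<psi>) p a"
      using directional_deriv_chart[OF p(1,2) dY] p(3) by simp
    moreover have "Dif (f \<circ> \<psi>) p a \<in> tangent_space A f m"
      using tangent_space_chart[OF p(1,2)] p(3) by auto
    ultimately show ?thesis
      using weingarten[OF U(1-3)] coordinate_field_chart[OF p(1,2)] p(3) by metis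
  qed
  have "C_k_on 2 W (f \<circ> \<psi>)"
    using immersion_smooth[OF p(1)] unfolding smooth_on_def by blast
  from mixed_derivatives_commute[OF chart_open[OF p(1)] p(2) this]
  show ?thesis unfolding ab * by metis
qed

text \<open>Differentiate \<open>N \<bullet> N = 1\<close>: the derivative of \<open>N\<close> is orthogonal to \<open>N\<close>.\<close>

lemma shape_operator_tangent:
  assumes m: "m \<in> topspace M" and X: "X \<in> tangent_space A f m"
  shows "shape_operator A f m X \<in> tangent_space A f m"
proof -
  obtain W \<psi> p where p: "(W, \<psi>) \<in> A" "p \<in> W" "m = \<psi> p" using point_in_chart[OF m] .
  obtain a where a: "X = Dif (f \<circ> \<psi>) p a"
    using X tangent_space_chart[OF p(1,2)] p(3) by auto
  have dN: "(N \<circ> \<psi>) differentiable at p" by (rule unit_normal_differentiable[OF p(1,2)])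
  have one: "(N \<circ> \<psi>) x \<bullet> (N \<circ> \<psi>) x = 1" if "x \<in> W" for x
    using norm_unit_normal[OF p(1) that] by (simp add: dot_square_norm)
  from has_derivative_transform_within_open[OF
      has_derivative_inner[OF differentiable_Dif[OF dN] differentiable_Dif[OF dN]] chart_open[OF p(1)] p(2) one]
  have "((\<lambda>x. 1) has_derivative
      (\<lambda>v. (N \<circ> \<psi>) p \<bullet> Dif (N \<circ> \<psi>) p v + Dif (N \<circ> \<psi>) p v \<bullet> (N \<circ> \<psi>) p)) (at p)" by simp
  from has_derivative_unique[OF this has_derivative_const]
  have "(N \<circ> \<psi>) p \<bullet> Dif (N \<circ> \<psi>) p a + Dif (N \<circ> \<psi>) p a \<bullet> (N \<circ> \<psi>) p = 0" by metis
  then have "Dif (N \<circ> \<psi>) p a \<bullet> N m = 0" by (simp add: p(3) inner_commute)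
  then show ?thesis
    using tangent_space_orthogonal[OF p(1,2)] shape_operator_chart[OF p(1,2)] by (simp add: a p(3))
qed

lemma shape_operator_combination:
  assumes m: "m \<in> topspace M" and X: "X \<in> tangent_space A f m" and y: "y \<in> tangent_space A f m"
  shows "shape_operator A f m (c *\<^sub>R X + d *\<^sub>R y)
    = c *\<^sub>R shape_operator A f m X + d *\<^sub>R shape_operator A f m y"
proof -
  obtain W \<psi> p where p: "(W, \<psi>) \<in> A" "p \<in> W" "m = \<psi> p" using point_in_chart[OF m] .
  obtain a b where ab: "X = Dif (f \<circ> \<psi>) p a" "y = Dif (f \<circ> \<psi>) p b"
    using X y tangent_space_chart[OF p(1,2)] p(3) by auto
  have "c *\<^sub>R X + d *\<^sub>R y = Dif (f \<circ> \<psi>) p (c *\<^sub>R a + d *\<^sub>R b)"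
    using differential_linear[OF p(1,2)] by (simp add: ab linear_add linear_cmul)
  moreover have "Dif (N \<circ> \<psi>) p (c *\<^sub>R a + d *\<^sub>R b) = c *\<^sub>R Dif (N \<circ> \<psi>) p a + d *\<^sub>R Dif (N \<circ> \<psi>) p b"
    using linear_frechet_derivative[OF unit_normal_differentiable[OF p(1,2)]] by (simp add: linear_add linear_cmul)
  ultimately show ?thesis using shape_operator_chart[OF p(1,2)] by (simp add: ab p(3))
qed


section \<open>Extremal directions of the frontal deviation\<close>

text \<open>The deviation is \<open>-q\<^sup>2/6\<close> with \<open>q = S u \<bullet> u\<close>. Turning \<open>\<theta>\<close> by a right angle gives the derivative of
  \<open>u\<close>, so self-adjointness of \<open>S\<close> yields \<open>q' = 2 S u \<bullet> u'\<close>.\<close>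

lemma frontal_deviation_derivative:
  assumes m: "m \<in> topspace M" and basis: "orthonormal_basis_of (tangent_space A f m) t1 t2"
  defines "u \<equiv> unit_direction t1 t2"
  shows "((\<lambda>\<theta>. frontal_deviation M A f m (u \<theta>)) has_real_derivative
    - (2/3) * (shape_operator A f m (u \<theta>) \<bullet> u \<theta>) * (shape_operator A f m (u \<theta>) \<bullet> u (\<theta> + pi/2))) (at \<theta>)"
proof -
  let ?S = "shape_operator A f m"
  have span: "span {t1, t2} = tangent_space A f m"
    using basis by (simp add: orthonormal_basis_of_def)
  have t: "t1 \<in> tangent_space A f m" "t2 \<in> tangent_space A f m"
    unfolding span[symmetric] by (auto intro: span_base)
  have u: "u \<theta> \<in> tangent_space A f m" for \<theta>
    unfolding span[symmetric] u_def unit_direction_def by (intro span_add span_scale span_base) auto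
  have Su: "?S (u \<theta>) = cos \<theta> *\<^sub>R ?S t1 + sin \<theta> *\<^sub>R ?S t2" for \<theta>
    unfolding u_def unit_direction_def by (rule shape_operator_combination[OF m t])
  have sym: "?S t2 \<bullet> t1 = ?S t1 \<bullet> t2" by (rule shape_operator_symmetric[OF m t(2,1)])
  have q: "?S (u \<theta>) \<bullet> u \<theta>
    = (?S t1 \<bullet> t1) * (cos \<theta>)\<^sup>2 + 2 * (?S t1 \<bullet> t2) * cos \<theta> * sin \<theta> + (?S t2 \<bullet> t2) * (sin \<theta>)\<^sup>2" for \<theta>
    unfolding Su by (simp add: sym u_def unit_direction_def inner_add_left inner_add_right power2_eq_square algebra_simps)
  have q': "?S (u \<theta>) \<bullet> u (\<theta> + pi/2)
    = - (?S t1 \<bullet> t1) * cos \<theta> * sin \<theta> + (?S t1 \<bullet> t2) * ((cos \<theta>)\<^sup>2 - (sin \<theta>)\<^sup>2) + (?S t2 \<bullet> t2) * cos \<theta> * sin \<theta>"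
    unfolding Su by (simp add: sym u_def unit_direction_def cos_add sin_add inner_add_left inner_add_right inner_diff_right power2_eq_square algebra_simps)
  have dq: "((\<lambda>\<theta>. ?S (u \<theta>) \<bullet> u \<theta>) has_real_derivative 2 * (?S (u \<theta>) \<bullet> u (\<theta> + pi/2))) (at \<theta>)"
    unfolding q q' by (auto intro!: derivative_eq_intros simp: power2_eq_square algebra_simps)
  have N1: "N m \<bullet> N m = 1" by (rule unit_normal_inner_self[OF m])
  have "frontal_deviation M A f m (u \<theta>) = - (1/6) * (?S (u \<theta>) \<bullet> u \<theta>)\<^sup>2" for \<theta>
    by (simp add: frontal_deviation_def second_fundamental_form_eq[OF m u u] N1 power2_eq_square)
  then show ?thesis
    using dq by (auto intro!: derivative_eq_intros)
qed

end

theorem mainTheorem3: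
  fixes M :: "'a topology" and A :: "'a param set" and f :: "'a \<Rightarrow> real^3"
    and m :: 'a and t1 t2 v :: "real^3"
  assumes "oriented_surface M A"
    and "immersion M A f"
    and "m \<in> topspace M"
    and "orthonormal_basis_of (tangent_space A f m) t1 t2"
    and "v \<in> tangent_space A f m" and "norm v = 1"
  shows "extremal_direction M A f m t1 t2 v \<longleftrightarrow>
    asymptotic_direction M A f m v \<or> principal_direction A f m v"
proof -
  interpret oriented_immersed_surface M A f using assms(1,2) by unfold_locales
  note m = assms(3) and basis = assms(4) and v = assms(5)
  let ?S = "shape_operator A f m" and ?u = "unit_direction t1 t2"
  have v0: "v \<noteq> 0" using assms(6) by auto
  have vcoord: "v = (v \<bullet> t1) *\<^sub>R t1 + (v \<bullet> t2) *\<^sub>R t2"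
    by (rule orthonormal_basis_expansion[OF basis v])
  have "v \<bullet> v = 1" using assms(6) by (simp add: dot_square_norm)
  then have "(v \<bullet> t1)\<^sup>2 + (v \<bullet> t2)\<^sup>2 = 1"
    by (subst (asm) (2) vcoord) (simp add: inner_add_right power2_eq_square)
  then obtain \<theta>0 where "v \<bullet> t1 = cos \<theta>0" "v \<bullet> t2 = sin \<theta>0"
    using sincos_total_2pi by metis
  then have ex: "v = ?u \<theta>0" using vcoord by (simp add: unit_direction_def)
  \<comment> \<open>Stated for every angle of \<open>v\<close>, since an extremal direction may be witnessed by any of them.\<close>
  have step: "((\<lambda>\<theta>. frontal_deviation M A f m (?u \<theta>)) has_real_derivative 0) (at \<theta>)
      \<longleftrightarrow> ?S v \<bullet> v = 0 \<or> (\<exists>k. ?S v = k *\<^sub>R v)" if \<theta>: "v = ?u \<theta>" for \<theta>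
  proof -
    have "((\<lambda>\<theta>. frontal_deviation M A f m (?u \<theta>)) has_real_derivative 0) (at \<theta>)
      \<longleftrightarrow> ?S v \<bullet> v = 0 \<or> ?S v \<bullet> ?u (\<theta> + pi/2) = 0"
      using frontal_deviation_derivative[OF m basis, of \<theta>] DERIV_unique
      unfolding \<theta>[symmetric] by fastforce
    moreover have "?S v \<bullet> ?u (\<theta> + pi/2) = 0 \<longleftrightarrow> (\<exists>k. ?S v = k *\<^sub>R v)"
      using eigenvector_iff_orthogonal_to_rotation[OF basis shape_operator_tangent[OF m v], of \<theta>]
      unfolding \<theta>[symmetric] by blast
    ultimately show ?thesis by blast
  qed
  have "extremal_direction M A f m t1 t2 v \<longleftrightarrow> ?S v \<bullet> v = 0 \<or> (\<exists>k. ?S v = k *\<^sub>R v)"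
    unfolding extremal_direction_def using ex step by blast
  moreover have "asymptotic_direction M A f m v \<longleftrightarrow> ?S v \<bullet> v = 0"
    using v v0 unit_normal_inner_self[OF m]
    by (simp add: asymptotic_direction_def normal_curvature_def second_fundamental_form_eq[OF m v v])
  ultimately show ?thesis using v v0 by (simp add: principal_direction_def)
qed

end
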